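(* Let $y>\pi$ and let $(x_n)_{n\ge0}$ be defined by Newton's iteration $$x_0=\frac1{\cosh y},\qquad x_{n+1}=x_n-\frac{\mu(x_n)-y}{\mu'(x_n)}\quad(n\ge 0).$$ Then $$0<x_n<x_{n+1}<\mu^{-1}(y)<3-2\sqrt2<1\qquad\text{for all } n\ge0 .$$
   Context: For $0<r<1$ let $r'=\sqrt{1-r^2}$ and let $$\mathbf K(r)=\int_0^{\pi/2}\frac{dt}{\sqrt{1-r^2\sin^2 t}}$$ be Legendre's complete elliptic integral of the first kind. The Grötzsch modulus function is $$\mu(r)=\frac{\pi}{2}\,\frac{\mathbf K(r')}{\mathbf K(r)},\qquad 0<r<1.$$ It is a smooth, strictly decreasing homeomorphism from $(0,1)$ onto $(0,\infty)$, and $\mu^{-1}:(0,\infty)\to(0,1)$ denotes its inverse. Its derivative is $\mu'(r)=-\dfrac{\pi^2}{4r(1-r^2)\mathbf K(r)^2}<0$. *)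

theory Defs
  imports "HOL-Analysis.Analysis"
begin

definition ellipticK :: "real \<Rightarrow> real" where
  "ellipticK r = integral {0..pi/2} (\<lambda>t. 1 / sqrt (1 - r\<^sup>2 * (sin t)\<^sup>2))"

text \<open>The argument \<open>r\<close> is meant to range over the open unit interval; values elsewhere carry
  no meaning.\<close>

definition groetzsch_mu :: "real \<Rightarrow> real" where
  "groetzsch_mu r = pi / 2 * (ellipticK (sqrt (1 - r\<^sup>2)) / ellipticK r)"

definition groetzsch_mu_inv :: "real \<Rightarrow> real" where
  "groetzsch_mu_inv = the_inv_into {0<..<1} groetzsch_mu"

end

theory Submission
  imports Defs
begin

text \<open>
  On an interval where \<open>\<mu>\<close> is strictly decreasing and strictly convex, its tangent at a point to the
  left of the solution \<open>\<xi>\<close> of \<open>\<mu>(\<xi>) = y\<close> lies below its graph and meets the level \<open>y\<close> strictly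
  between that point and \<open>\<xi>\<close>. So Newton's iteration increases and stays below \<open>\<xi>\<close>
  (\<open>newton_step_below_root\<close>). Three facts about \<open>\<mu>\<close> remain.

  Convexity up to \<open>1 / \<surd>3\<close>. As a function of \<open>m = r\<^sup>2\<close>, the integral \<open>\<^bold>K\<close> solves a linear differential
  equation of second order that is symmetric under \<open>m \<mapsto> 1 - m\<close>, so numerator and denominator of \<open>\<mu>\<close>
  are two solutions of it. Constancy of their Wronskian gives \<open>\<mu>'(r) = c / (r (1 - r\<^sup>2) \<^bold>K(r)\<^sup>2)\<close>
  with a constant \<open>c < 0\<close> (\<open>DERIV_groetzsch_mu\<close>), and the denominator increases as long as
  \<open>3 r\<^sup>2 \<le> 1\<close>.

  The solution lies below \<open>3 - 2 \<surd>2\<close>. Indeed \<open>\<mu>(3 - 2 \<surd>2) = \<pi> < y\<close> (\<open>groetzsch_mu_at_pi\<close>). This value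
  follows from the invariance of the elliptic integral under replacing two numbers by their arithmetic
  and geometric means (\<open>gauss_integral_agm_step\<close>), applied to the pairs \<open>(1 + k, 1 - k)\<close> and
  \<open>(1, k)\<close>. For \<open>k = 3 - 2 \<surd>2\<close> the first pair is twice the pair of means of the second.

  The starting point lies to the left of the solution, that is, \<open>\<mu>(1 / cosh y) > y\<close>
  (\<open>groetzsch_mu_sech_gt\<close>). Write \<open>s = tanh y\<close> for the complementary modulus of \<open>r = 1 / cosh y\<close>.
  Elementary pointwise bounds of the integrands give \<open>\<^bold>K(s) > y / \<surd>s\<close> and \<open>\<^bold>K(r) \<le> \<pi> / (2 \<surd>s)\<close>, whose
  quotient is exactly what is needed.
\<close>

section \<open>The complete elliptic integral as a function of the parameter\<close>

text \<open>In terms of the parameter \<open>m = r\<^sup>2\<close>, the integral \<open>\<^bold>K\<close> is the member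
  \<open>n = 0\<close>, \<open>p = -1/2\<close> of this family. The family is closed under differentiation in \<open>m\<close>, so a
  single differentiation rule gives all derivatives of \<open>\<^bold>K\<close>. The parameter is preferable to the
  modulus \<open>r\<close> because passing to the complementary modulus becomes the reflection
  \<open>m \<mapsto> 1 - m\<close>.\<close>
definition elliptic_moment :: "nat \<Rightarrow> real \<Rightarrow> real \<Rightarrow> real" where
  "elliptic_moment n p m =
     integral {0..pi/2} (\<lambda>t. (sin t) ^ (2 * n) * (1 - m * (sin t)\<^sup>2) powr p)"

lemma one_minus_sin_square_pos:
  fixes m t :: real
  assumes "m < 1"
  shows "0 < 1 - m * (sin t)\<^sup>2"
proof -
  have s: "0 \<le> (sin t)\<^sup>2" "(sin t)\<^sup>2 \<le> 1"
    by (simp_all add: abs_square_le_1)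
  show ?thesis
  proof (cases "0 < m")
    case True
    then have "m * (sin t)\<^sup>2 \<le> m * 1"
      using s by (intro mult_left_mono) auto
    with assms show ?thesis by simp
  next
    case False
    then have "m * (sin t)\<^sup>2 \<le> 0"
      using s by (intro mult_nonpos_nonneg) auto
    then show ?thesis by simp
  qed
qed

lemma continuous_on_elliptic_moment_integrand:
  fixes m p :: real
  assumes "m < 1"
  shows "continuous_on A (\<lambda>t. (sin t) ^ k * (1 - m * (sin t)\<^sup>2) powr p)"
  using one_minus_sin_square_pos[OF assms]
  by (intro continuous_intros) (auto simp: less_imp_neq[symmetric])

lemma elliptic_moment_pos:
  assumes "m < 1"
  shows "0 < elliptic_moment n p m"
proof -
  have "integral {0..pi/2} (\<lambda>t. 0) < elliptic_moment n p m"
    unfolding elliptic_moment_def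
  proof (rule integral_less_real)
    fix t assume "t \<in> {0<..<pi/2}"
    then have "0 < sin t" by (intro sin_gt_zero) auto
    then show "0 < (sin t) ^ (2 * n) * (1 - m * (sin t)\<^sup>2) powr p"
      using one_minus_sin_square_pos[OF assms, of t] by simp
  qed (auto intro: continuous_on_elliptic_moment_integrand[OF assms] simp: not_le)
  then show ?thesis by simp
qed

lemma DERIV_elliptic_moment:
  assumes "m < 1"
  shows "(elliptic_moment n p has_real_derivative
            - p * elliptic_moment (Suc n) (p - 1) m) (at m)"
proof -
  let ?f = "\<lambda>m t. (sin t) ^ (2 * n) * (1 - m * (sin t)\<^sup>2) powr p"
  let ?g = "\<lambda>m t. - p * ((sin t) ^ (2 * Suc n) * (1 - m * (sin t)\<^sup>2) powr (p - 1))"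
  have "((\<lambda>m. integral (cbox 0 (pi/2)) (?f m)) has_real_derivative
           integral (cbox 0 (pi/2)) (?g m)) (at m within {..<1})"
  proof (rule leibniz_rule_field_derivative)
    fix m t :: real assume "m \<in> {..<1}"
    then show "((\<lambda>m. ?f m t) has_real_derivative ?g m t) (at m within {..<1})"
      using one_minus_sin_square_pos[of m t]
      by (auto intro!: derivative_eq_intros simp: powr_diff power2_eq_square)
  next
    fix m :: real assume "m \<in> {..<1}"
    then show "?f m integrable_on cbox 0 (pi/2)"
      unfolding cbox_interval
      by (intro integrable_continuous_real continuous_on_elliptic_moment_integrand) auto
  next
    show "continuous_on ({..<1} \<times> cbox 0 (pi/2)) (\<lambda>(m, t). ?g m t)"
      using one_minus_sin_square_pos
      by (auto intro!: continuous_intros simp: case_prod_unfold less_imp_neq[symmetric])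
  qed (use assms in auto)
  moreover have "at m within {..<1} = at m"
    using assms by (intro at_within_open) auto
  ultimately show ?thesis
    by (simp add: elliptic_moment_def[abs_def])
qed

text \<open>This is the hypergeometric equation \<open>(m (1 - m) F')' = F / 4\<close> for \<open>F(m) = \<^bold>K(\<surd>m)\<close>, with \<open>F'\<close> and
  \<open>F''\<close> written as moments. With \<open>D = 1 - m sin\<^sup>2 t\<close>, the integrand of the difference of the two
  sides is the exact derivative of \<open>- sin t cos t D powr (-3/2) / 4\<close>, which vanishes at both
  ends of the interval of integration.\<close>
lemma elliptic_moment_ode:
  assumes "m < 1"
  shows "3/4 * m * (1 - m) * elliptic_moment 2 (-5/2) m
          + 1/2 * (1 - 2 * m) * elliptic_moment 1 (-3/2) m
         = 1/4 * elliptic_moment 0 (-1/2) m"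
proof -
  define D where "D t = 1 - m * (sin t)\<^sup>2" for t
  define I where "I n p t = (sin t) ^ (2 * n) * D t powr p" for n p t
  have Dpos: "0 < D t" for t
    unfolding D_def by (rule one_minus_sin_square_pos[OF assms])
  have hI: "(I n p has_integral elliptic_moment n p m) {0..pi/2}" for n p
    unfolding elliptic_moment_def I_def[abs_def] D_def
    by (intro integrable_integral integrable_continuous_real
          continuous_on_elliptic_moment_integrand assms)
  have pw: "D t powr (-1/2) = (D t)\<^sup>2 * D t powr (-5/2)" "D t powr (-3/2) = D t * D t powr (-5/2)" for t
    using Dpos[of t] powr_add[of "D t" 2 "-5/2"] powr_add[of "D t" 1 "-5/2"]
    by (simp_all add: powr_numeral)
  have "((\<lambda>t. 3/4 * m * (1 - m) * I 2 (-5/2) t + 1/2 * (1 - 2 * m) * I 1 (-3/2) t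
           - 1/4 * I 0 (-1/2) t) has_integral
         (- 1/4 * (sin (pi/2) * cos (pi/2) * D (pi/2) powr (-3/2)))
         - (- 1/4 * (sin 0 * cos 0 * D 0 powr (-3/2)))) {0..pi/2}"
  proof (rule fundamental_theorem_of_calculus)
    fix t assume "t \<in> {0..pi/2}"
    have c: "(cos t)\<^sup>2 = 1 - (sin t)\<^sup>2"
      by (simp add: cos_squared_eq)
    have "((\<lambda>t. - 1/4 * (sin t * cos t * D t powr (-3/2))) has_real_derivative
             - 1/4 * (((cos t)\<^sup>2 - (sin t)\<^sup>2) * D t powr (-3/2)
                + 3 * m * (sin t)\<^sup>2 * (cos t)\<^sup>2 * D t powr (-5/2))) (at t within {0..pi/2})"
      unfolding D_def using Dpos[of t, unfolded D_def]
      by (auto intro!: derivative_eq_intros simp: powr_diff power2_eq_square field_simps)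
    also have "- 1/4 * (((cos t)\<^sup>2 - (sin t)\<^sup>2) * D t powr (-3/2)
                + 3 * m * (sin t)\<^sup>2 * (cos t)\<^sup>2 * D t powr (-5/2))
       = 3/4 * m * (1 - m) * I 2 (-5/2) t + 1/2 * (1 - 2 * m) * I 1 (-3/2) t
           - 1/4 * I 0 (-1/2) t"
      unfolding I_def pw c unfolding D_def by (simp add: field_simps power2_eq_square power4_eq_xxxx)
    finally show "((\<lambda>t. - 1/4 * (sin t * cos t * D t powr (-3/2))) has_vector_derivative
        3/4 * m * (1 - m) * I 2 (-5/2) t + 1/2 * (1 - 2 * m) * I 1 (-3/2) t
           - 1/4 * I 0 (-1/2) t) (at t within {0..pi/2})"
      by (simp add: has_real_derivative_iff_has_vector_derivative)
  qed simp
  moreover have "((\<lambda>t. 3/4 * m * (1 - m) * I 2 (-5/2) t + 1/2 * (1 - 2 * m) * I 1 (-3/2) t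
           - 1/4 * I 0 (-1/2) t) has_integral
      3/4 * m * (1 - m) * elliptic_moment 2 (-5/2) m
      + 1/2 * (1 - 2 * m) * elliptic_moment 1 (-3/2) m
      - 1/4 * elliptic_moment 0 (-1/2) m) {0..pi/2}"
    by (intro has_integral_diff has_integral_add has_integral_mult_right hI)
  ultimately show ?thesis
    by (simp add: has_integral_unique[THEN sym] has_integral_iff)
qed


lemma ellipticK_eq_elliptic_moment:
  assumes "0 \<le> 1 - r\<^sup>2"
  shows "ellipticK r = elliptic_moment 0 (-1/2) (r\<^sup>2)"
proof -
  have "1 / sqrt (1 - r\<^sup>2 * (sin t)\<^sup>2) = (1 - r\<^sup>2 * (sin t)\<^sup>2) powr (-1/2)" for t
  proof -
    have "r\<^sup>2 * (sin t)\<^sup>2 \<le> 1 * 1"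
      using assms by (intro mult_mono) (auto simp: abs_square_le_1)
    then show ?thesis
      by (simp add: powr_minus powr_half_sqrt inverse_eq_divide)
  qed
  then show ?thesis
    by (simp add: ellipticK_def elliptic_moment_def)
qed

lemma ellipticK_pos:
  assumes "0 \<le> r" "r < 1"
  shows "0 < ellipticK r"
proof -
  have "r\<^sup>2 < 1" using assms by (simp add: abs_square_less_1)
  then show ?thesis
    by (simp add: ellipticK_eq_elliptic_moment elliptic_moment_pos)
qed

section \<open>Derivative and convexity of the modulus function\<close>

text \<open>The equation for \<open>F\<close> is invariant under \<open>m \<mapsto> 1 - m\<close>, so \<open>F(1 - m)\<close> is a second solution, and
  the Wronskian of the two, weighted by \<open>m (1 - m)\<close>, is a constant \<open>c\<close>. It is negative because
  \<open>F\<close> and \<open>F'\<close> are positive. (By Legendre's relation, \<open>c = - \<pi> / 4\<close>.)\<close>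
lemma DERIV_complementary_quotient:
  obtains c where "c < 0"
    and "\<And>m. m \<in> {0<..<1} \<Longrightarrow>
      ((\<lambda>m. elliptic_moment 0 (-1/2) (1 - m) / elliptic_moment 0 (-1/2) m)
        has_real_derivative c / (m * (1 - m) * (elliptic_moment 0 (-1/2) m)\<^sup>2)) (at m)"
proof -
  define F where "F = elliptic_moment 0 (-1/2)"
  define F1 where "F1 m = 1/2 * elliptic_moment 1 (-3/2) m" for m
  define F2 where "F2 m = 3/4 * elliptic_moment 2 (-5/2) m" for m
  have dF: "(F has_real_derivative F1 m) (at m)" if "m < 1" for m
    using DERIV_elliptic_moment[OF that, of 0 "-1/2"] by (simp add: F_def F1_def)
  have dF1: "(F1 has_real_derivative F2 m) (at m)" if "m < 1" for m
    using DERIV_cmult[OF DERIV_elliptic_moment[OF that, of 1 "-3/2"], of "1/2"]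
    by (simp add: F1_def[abs_def] F2_def numeral_2_eq_2)
  have ode: "m * (1 - m) * F2 m + (1 - 2 * m) * F1 m = F m / 4" if "m < 1" for m
    using elliptic_moment_ode[OF that] by (simp add: F_def F1_def F2_def)
  have pos: "0 < F m" "0 < F1 m" if "m < 1" for m
    using elliptic_moment_pos[OF that] by (simp_all add: F_def F1_def)
  have dm: "((\<lambda>m. 1 - m) has_real_derivative -1) (at m)" for m :: real
    by (auto intro!: derivative_eq_intros)
  have dG: "((\<lambda>m. F (1 - m)) has_real_derivative - F1 (1 - m)) (at m)" if "0 < m" for m
    using DERIV_chain2[OF dF[of "1 - m"] dm] that by simp
  have dG1: "((\<lambda>m. F1 (1 - m)) has_real_derivative - F2 (1 - m)) (at m)" if "0 < m" for m
    using DERIV_chain2[OF dF1[of "1 - m"] dm] that by simp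
  define W where "W m = m * (1 - m) * (- F1 (1 - m) * F m - F (1 - m) * F1 m)" for m
  have dW: "(W has_real_derivative 0) (at m)" if "m \<in> {0<..<1}" for m
  proof -
    have m: "0 < m" "m < 1" "1 - m < 1" using that by auto
    have o1: "F m = 4 * (m * (1 - m) * F2 m + (1 - 2 * m) * F1 m)"
      using ode[OF m(2)] by simp
    have o2: "F (1 - m) = 4 * (m * (1 - m) * F2 (1 - m) - (1 - 2 * m) * F1 (1 - m))"
      using ode[OF m(3)] by (simp add: algebra_simps)
    have "(W has_real_derivative
        (1 - 2 * m) * (- F1 (1 - m) * F m - F (1 - m) * F1 m)
        + m * (1 - m) * (F2 (1 - m) * F m - F (1 - m) * F2 m)) (at m)"
      unfolding W_def[abs_def]
      by (rule DERIV_cong[OF DERIV_mult[OF DERIV_mult[OF DERIV_ident dm]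
            DERIV_diff[OF DERIV_mult[OF DERIV_minus[OF dG1[OF m(1)]] dF[OF m(2)]]
              DERIV_mult[OF dG[OF m(1)] dF1[OF m(2)]]]]]) (simp add: algebra_simps)
    also have "(1 - 2 * m) * (- F1 (1 - m) * F m - F (1 - m) * F1 m)
        + m * (1 - m) * (F2 (1 - m) * F m - F (1 - m) * F2 m) = 0"
      unfolding o1 o2 by (simp add: algebra_simps)
    finally show ?thesis .
  qed
  define c where "c = W (1/2)"
  have Wc: "W m = c" if "m \<in> {0<..<1}" for m
  proof -
    have "\<exists>k. \<forall>x\<in>{0<..<1}. W x = k"
      by (rule has_field_derivative_zero_constant)
        (simp, rule has_field_derivative_at_within, rule dW)
    then obtain k where "\<And>x. x \<in> {0<..<1} \<Longrightarrow> W x = k" by blast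
    from this[OF that] this[of "1/2"] show ?thesis
      by (simp add: c_def)
  qed
  have "c < 0"
  proof -
    have "0 < F1 (1/2) * F (1/2)"
      using pos[of "1/2"] by simp
    then show ?thesis by (simp add: c_def W_def)
  qed
  moreover have "((\<lambda>m. F (1 - m) / F m) has_real_derivative c / (m * (1 - m) * (F m)\<^sup>2)) (at m)"
    if "m \<in> {0<..<1}" for m
  proof -
    have m: "0 < m" "m < 1" using that by auto
    have "((\<lambda>m. F (1 - m) / F m) has_real_derivative
            (- F1 (1 - m) * F m - F (1 - m) * F1 m) / (F m * F m)) (at m)"
      by (rule DERIV_divide[OF dG[OF m(1)] dF[OF m(2)]]) (use pos(1)[OF m(2)] in simp)
    also have "(- F1 (1 - m) * F m - F (1 - m) * F1 m) / (F m * F m) = W m / (m * (1 - m) * (F m)\<^sup>2)"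
      using m by (simp add: W_def power2_eq_square)
    finally show ?thesis
      by (simp add: Wc[OF that])
  qed
  ultimately show ?thesis
    unfolding F_def by (rule that)
qed

lemma DERIV_groetzsch_mu:
  obtains c where "c < 0"
    and "\<And>r. r \<in> {0<..<1} \<Longrightarrow>
      (groetzsch_mu has_real_derivative c / (r * (1 - r\<^sup>2) * (ellipticK r)\<^sup>2)) (at r)"
proof -
  let ?F = "elliptic_moment 0 (-1/2)"
  obtain c where c: "c < 0" and
    dq: "\<And>m. m \<in> {0<..<1} \<Longrightarrow> ((\<lambda>m. ?F (1 - m) / ?F m)
      has_real_derivative c / (m * (1 - m) * (?F m)\<^sup>2)) (at m)"
    by (rule DERIV_complementary_quotient) blast
  have "(groetzsch_mu has_real_derivative pi * c / (r * (1 - r\<^sup>2) * (ellipticK r)\<^sup>2)) (at r)"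
    if r: "r \<in> {0<..<1}" for r
  proof -
    have sq: "x\<^sup>2 \<in> {0<..<1}" if "x \<in> {0<..<1}" for x :: real
      using that by (auto simp: abs_square_less_1)
    have mu: "groetzsch_mu x = pi / 2 * (?F (1 - x\<^sup>2) / ?F (x\<^sup>2))" if "x \<in> {0<..<1}" for x
      using sq[OF that] by (simp add: groetzsch_mu_def ellipticK_eq_elliptic_moment)
    have "((\<lambda>x. ?F (1 - x\<^sup>2) / ?F (x\<^sup>2)) has_real_derivative
             c / (r\<^sup>2 * (1 - r\<^sup>2) * (?F (r\<^sup>2))\<^sup>2) * (2 * r)) (at r)"
      by (rule DERIV_chain2[where g = "\<lambda>x. x\<^sup>2" and x = r, OF dq[OF sq[OF r]]])
        (auto intro!: derivative_eq_intros)
    then have "((\<lambda>x. pi / 2 * (?F (1 - x\<^sup>2) / ?F (x\<^sup>2))) has_real_derivative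
             pi * c / (r * (1 - r\<^sup>2) * (?F (r\<^sup>2))\<^sup>2)) (at r)"
      by (rule DERIV_cong[OF DERIV_cmult]) (use r in \<open>simp add: power2_eq_square\<close>)
    also have "?F (r\<^sup>2) = ellipticK r"
      using sq[OF r] by (simp add: ellipticK_eq_elliptic_moment)
    finally show ?thesis
      by (rule has_field_derivative_transform_within_open[of _ _ _ "{0<..<1}"])
        (simp, rule r, simp only: mu)
  qed
  moreover have "pi * c < 0"
    using c by (simp add: mult_pos_neg)
  ultimately show ?thesis by (intro that)
qed

lemma ellipticK_mono:
  assumes "0 \<le> r" "r < s" "s < 1"
  shows "ellipticK r < ellipticK s"
proof -
  have rs: "r\<^sup>2 < s\<^sup>2" and s: "s\<^sup>2 < 1"
    using assms by (auto simp: power_strict_mono abs_square_less_1)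
  have "elliptic_moment 0 (-1/2) (r\<^sup>2) < elliptic_moment 0 (-1/2) (s\<^sup>2)"
  proof (rule DERIV_pos_imp_increasing[OF rs])
    fix m assume "m \<le> s\<^sup>2"
    with s have "m < 1" by simp
    then show "\<exists>y. (elliptic_moment 0 (-1/2) has_real_derivative y) (at m) \<and> 0 < y"
      by (intro exI conjI, rule DERIV_elliptic_moment) (simp_all add: elliptic_moment_pos)
  qed
  with rs s show ?thesis
    by (simp add: ellipticK_eq_elliptic_moment)
qed

text \<open>By the formula \<open>\<mu>' = c / P\<close> with \<open>P(r) = r (1 - r\<^sup>2) \<^bold>K(r)\<^sup>2\<close>, strict convexity of \<open>\<mu>\<close> amounts to
  strict growth of \<open>P\<close>. Here \<open>\<^bold>K\<close> increases on the whole unit interval, and \<open>r (1 - r\<^sup>2)\<close> increases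
  exactly up to \<open>1 / \<surd>3\<close>, which lies well beyond \<open>3 - 2 \<surd>2\<close>.\<close>
lemma deriv_groetzsch_mu:
  shows "\<And>r. r \<in> {0<..<1} \<Longrightarrow> groetzsch_mu field_differentiable at r" 
    and "\<And>r. r \<in> {0<..<1} \<Longrightarrow> deriv groetzsch_mu r < 0"
    and "\<And>r s. 0 < r \<Longrightarrow> r < s \<Longrightarrow> 3 * s\<^sup>2 \<le> 1 \<Longrightarrow> deriv groetzsch_mu r < deriv groetzsch_mu s"
proof -
  define P where "P r = r * (1 - r\<^sup>2) * (ellipticK r)\<^sup>2" for r
  obtain c where c: "c < 0"
    and d: "\<And>r. r \<in> {0<..<1} \<Longrightarrow> (groetzsch_mu has_real_derivative c / P r) (at r)"
    unfolding P_def by (rule DERIV_groetzsch_mu) blast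
  have P: "0 < P r" if "r \<in> {0<..<1}" for r
    using that ellipticK_pos[of r] unfolding P_def
    by (intro mult_pos_pos) (auto simp: abs_square_less_1)
  have D: "deriv groetzsch_mu r = c / P r" if "r \<in> {0<..<1}" for r
    using d[OF that] by (rule DERIV_imp_deriv)
  show "groetzsch_mu field_differentiable at r" if "r \<in> {0<..<1}" for r
    using d[OF that] by (auto simp: field_differentiable_def)
  show "deriv groetzsch_mu r < 0" if "r \<in> {0<..<1}" for r
    using c P[OF that] D[OF that] by (simp add: divide_neg_pos)
  show "deriv groetzsch_mu r < deriv groetzsch_mu s" if rs: "0 < r" "r < s" "3 * s\<^sup>2 \<le> 1" for r s
  proof -
    have "s\<^sup>2 < 1" using rs by simp
    then have s: "s < 1" using rs by (simp add: abs_square_less_1)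
    have "r * s \<le> s * s" "r * r \<le> s * s" using rs by (auto intro: mult_mono)
    \<comment> \<open>The product is \<open>s (1 - s\<^sup>2) - r (1 - r\<^sup>2)\<close>.\<close>
    then have "(s - r) * (1 - s\<^sup>2 - r * s - r\<^sup>2) \<ge> 0"
      using rs by (intro mult_nonneg_nonneg) (unfold power2_eq_square, linarith+)
    then have 1: "r * (1 - r\<^sup>2) \<le> s * (1 - s\<^sup>2)"
      by (simp add: algebra_simps power2_eq_square)
    have 2: "(ellipticK r)\<^sup>2 < (ellipticK s)\<^sup>2"
      using ellipticK_mono[of r s] ellipticK_pos[of r] rs s by (intro power_strict_mono) auto
    have "P r < P s"
      unfolding P_def
      using 1 2 rs s by (intro mult_le_less_imp_less) (auto simp: abs_square_less_1)
    then show ?thesis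
      using c P[of r] rs s D[of r] D[of s] by (simp add: divide_strict_left_mono_neg)
  qed
qed

lemma groetzsch_mu_strict_antimono:
  assumes "0 < r" "r < s" "s < 1"
  shows "groetzsch_mu s < groetzsch_mu r"
proof (rule DERIV_neg_imp_decreasing[OF \<open>r < s\<close>])
  fix x assume "r \<le> x" "x \<le> s"
  with assms have x: "x \<in> {0<..<1}" by simp
  have "(groetzsch_mu has_real_derivative deriv groetzsch_mu x) (at x)"
    using deriv_groetzsch_mu(1)[OF x] by (simp add: DERIV_deriv_iff_field_differentiable)
  with deriv_groetzsch_mu(2)[OF x]
  show "\<exists>y. (groetzsch_mu has_real_derivative y) (at x) \<and> y < 0" by blast
qed

section \<open>Invariance under the arithmetic-geometric mean\<close>

text \<open>Gauss's two-parameter form of \<open>\<^bold>K\<close>, whose value is \<open>\<pi> / 2\<close> divided by the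
  arithmetic-geometric mean of \<open>a\<close> and \<open>b\<close>.\<close>
definition gauss_integral :: "real \<Rightarrow> real \<Rightarrow> real" where
  "gauss_integral a b =
     integral {0..pi/2} (\<lambda>t. 1 / sqrt (a\<^sup>2 * (cos t)\<^sup>2 + b\<^sup>2 * (sin t)\<^sup>2))"

lemma weighted_cos_sin_pos:
  fixes a b t :: real
  assumes "0 < a" "0 < b"
  shows "0 < a * (cos t)\<^sup>2 + b * (sin t)\<^sup>2"
proof (cases "sin t = 0")
  case True
  then have "(cos t)\<^sup>2 = 1" by (simp add: cos_squared_eq)
  with True assms show ?thesis by simp
next
  case False
  with assms show ?thesis by (intro add_nonneg_pos) auto
qed

lemma weighted_cos_sin_square:
  fixes a b t :: real
  shows "(a * (cos t)\<^sup>2 + b * (sin t)\<^sup>2)\<^sup>2 + ((a - b) * (sin t * cos t))\<^sup>2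
           = a\<^sup>2 * (cos t)\<^sup>2 + b\<^sup>2 * (sin t)\<^sup>2"
  unfolding cos_squared_eq power_mult_distrib by (simp add: algebra_simps power2_eq_square)

text \<open>The function differentiated here is the branch of \<open>arctan ((b / a) tan t)\<close> that stays smooth
  where \<open>tan\<close> has its pole: \<open>arctan ((b / a) tan t)\<close> is subtracted from \<open>t\<close> by the addition
  theorem, and the resulting tangent has a denominator without zeros.\<close>
lemma DERIV_arctan_scaled_tan:
  fixes a b t :: real
  assumes "0 < a" "0 < b"
  shows "((\<lambda>t. t - arctan ((a - b) * (sin t * cos t) / (a * (cos t)\<^sup>2 + b * (sin t)\<^sup>2)))
           has_real_derivative a * b / (a\<^sup>2 * (cos t)\<^sup>2 + b\<^sup>2 * (sin t)\<^sup>2)) (at t within A)"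
proof -
  define s c where "s = sin t" and "c = cos t"
  define M where "M = a * c\<^sup>2 + b * s\<^sup>2"
  define N where "N = (a - b) * (s * c)"
  define D where "D = a\<^sup>2 * c\<^sup>2 + b\<^sup>2 * s\<^sup>2"
  have M: "0 < M" unfolding M_def s_def c_def by (rule weighted_cos_sin_pos[OF assms])
  have D: "0 < D" unfolding D_def s_def c_def by (rule weighted_cos_sin_pos) (use assms in auto)
  have MN: "M\<^sup>2 + N\<^sup>2 = D"
    unfolding M_def N_def D_def s_def c_def by (rule weighted_cos_sin_square)
  have cs: "c\<^sup>2 = 1 - s\<^sup>2" unfolding s_def c_def by (rule cos_squared_eq)
  have M0: "a * (cos t)\<^sup>2 + b * (sin t)\<^sup>2 \<noteq> 0"
    using M unfolding M_def s_def c_def by simp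
  define N' where "N' = (a - b) * (c\<^sup>2 - s\<^sup>2)"
  define M' where "M' = 2 * (b - a) * (s * c)"
  have "((\<lambda>t. (a - b) * (sin t * cos t) / (a * (cos t)\<^sup>2 + b * (sin t)\<^sup>2))
      has_real_derivative (N' * M - N * M') / (M * M)) (at t within A)"
    using M0
    by (auto intro!: derivative_eq_intros
        simp: N_def M_def N'_def M'_def s_def c_def algebra_simps power2_eq_square)
  from DERIV_chain2[OF DERIV_arctan this]
  have "((\<lambda>t. arctan ((a - b) * (sin t * cos t) / (a * (cos t)\<^sup>2 + b * (sin t)\<^sup>2)))
      has_real_derivative inverse (1 + (N / M)\<^sup>2) * ((N' * M - N * M') / (M * M))) (at t within A)"
    by (simp add: N_def M_def s_def c_def)
  also have "inverse (1 + (N / M)\<^sup>2) = M\<^sup>2 / D"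
    using M D MN[symmetric] by (simp add: field_simps)
  also have "M\<^sup>2 / D * ((N' * M - N * M') / (M * M)) = (N' * M - N * M') / D"
    using M by (simp add: power2_eq_square)
  also have "N' * M - N * M' = D - a * b"
  proof -
    have "N' * M - N * M' = (a - b) * ((c\<^sup>2 - s\<^sup>2) * (a * c\<^sup>2 + b * s\<^sup>2) + 2 * (a - b) * (s\<^sup>2 * c\<^sup>2))"
      unfolding N'_def M'_def N_def M_def by (simp add: algebra_simps power2_eq_square)
    also have "\<dots> = D - a * b"
      unfolding D_def cs by (simp add: algebra_simps power2_eq_square)
    finally show ?thesis .
  qed
  finally have "((\<lambda>t. t - arctan ((a - b) * (sin t * cos t) / (a * (cos t)\<^sup>2 + b * (sin t)\<^sup>2)))
      has_real_derivative 1 - (D - a * b) / D) (at t within A)"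
    by (intro derivative_intros)
  also have "1 - (D - a * b) / D = a * b / D"
    using D by (simp add: field_simps)
  finally show ?thesis by (simp add: D_def s_def c_def)
qed

lemma continuous_on_gauss_integrand:
  fixes a b :: real
  assumes "0 < a" "0 < b"
  shows "continuous_on A (\<lambda>t. 1 / sqrt (a\<^sup>2 * (cos t)\<^sup>2 + b\<^sup>2 * (sin t)\<^sup>2))"
  using weighted_cos_sin_pos[of "a\<^sup>2" "b\<^sup>2"] assms
  by (intro continuous_intros) (auto simp: less_imp_neq[symmetric])

text \<open>The integrand is even and has period \<open>\<pi>\<close>.\<close>
lemma gauss_integral_half_period:
  assumes "0 < a" "0 < b"
  shows "integral {0..pi} (\<lambda>t. 1 / sqrt (a\<^sup>2 * (cos t)\<^sup>2 + b\<^sup>2 * (sin t)\<^sup>2))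
           = 2 * gauss_integral a b"
proof -
  let ?f = "\<lambda>t. 1 / sqrt (a\<^sup>2 * (cos t)\<^sup>2 + b\<^sup>2 * (sin t)\<^sup>2)"
  have cont: "continuous_on A ?f" for A
    by (rule continuous_on_gauss_integrand[OF assms])
  have "integral {pi/2..pi} ?f = integral {-pi/2..0} (?f \<circ> (\<lambda>x. x + pi))"
    by (subst integral_shift) (auto intro: cont simp: field_simps)
  also have "?f \<circ> (\<lambda>x. x + pi) = (\<lambda>x. ?f (- x))"
    by (simp add: fun_eq_iff)
  also have "integral {-pi/2..0} (\<lambda>x. ?f (- x)) = integral {0..pi/2} ?f"
    using Henstock_Kurzweil_Integration.integral_reflect_real[of "pi/2" 0 ?f] by simp
  finally have "integral {pi/2..pi} ?f = integral {0..pi/2} ?f" .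
  moreover have "integral {0..pi/2} ?f + integral {pi/2..pi} ?f = integral {0..pi} ?f"
    by (rule Henstock_Kurzweil_Integration.integral_combine)
      (use pi_gt_zero in \<open>auto intro: integrable_continuous_real cont\<close>)
  ultimately show ?thesis
    by (simp add: gauss_integral_def)
qed

text \<open>Landen's substitution \<open>\<phi> = t + arctan ((b / a) tan t)\<close>, that is, \<open>tan (\<phi> - t) = (b / a) tan t\<close>.
  It turns the quadratic form belonging to the two means of \<open>a\<close> and \<open>b\<close> into a perfect square
  divided by the form belonging to \<open>a\<close> and \<open>b\<close>. The reason is that \<open>\<surd>D cos \<phi>\<close>
  and \<open>\<surd>D sin \<phi>\<close> are \<open>a cos\<^sup>2 t - b sin\<^sup>2 t\<close> and \<open>(a + b) sin t cos t\<close>.\<close>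
lemma landen_substitution:
  fixes a b t :: real
  assumes "0 < a" "0 < b"
  defines "M \<equiv> a * (cos t)\<^sup>2 + b * (sin t)\<^sup>2"
    and "D \<equiv> a\<^sup>2 * (cos t)\<^sup>2 + b\<^sup>2 * (sin t)\<^sup>2"
    and "\<phi> \<equiv> 2 * t - arctan ((a - b) * (sin t * cos t) / (a * (cos t)\<^sup>2 + b * (sin t)\<^sup>2))"
  shows "((a + b) / 2)\<^sup>2 * (cos \<phi>)\<^sup>2 + (sqrt (a * b))\<^sup>2 * (sin \<phi>)\<^sup>2 = ((a + b) / 2 * M)\<^sup>2 / D"
proof -
  define s c where "s = sin t" and "c = cos t"
  define N where "N = (a - b) * (s * c)"
  define \<alpha> where "\<alpha> = arctan (N / M)"
  have M: "0 < M" unfolding M_def by (rule weighted_cos_sin_pos[OF assms(1,2)])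
  have D: "0 < D" unfolding D_def by (rule weighted_cos_sin_pos) (use assms in auto)
  have MN: "M\<^sup>2 + N\<^sup>2 = D"
    unfolding M_def N_def D_def s_def c_def by (rule weighted_cos_sin_square)
  have cs: "c\<^sup>2 = 1 - s\<^sup>2" unfolding s_def c_def by (rule cos_squared_eq)
  have "1 + (N / M)\<^sup>2 = D / M\<^sup>2"
    using M by (simp add: MN[symmetric] field_simps)
  then have r: "sqrt (1 + (N / M)\<^sup>2) = sqrt D / M"
    using M by (simp add: real_sqrt_divide)
  have ca: "cos \<alpha> = M / sqrt D" and sa: "sin \<alpha> = N / sqrt D"
    unfolding \<alpha>_def cos_arctan sin_arctan r using M D by auto
  have phi: "\<phi> = 2 * t - \<alpha>"
    unfolding \<phi>_def \<alpha>_def N_def M_def s_def c_def ..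
  have "cos \<phi> = ((c\<^sup>2 - s\<^sup>2) * M + 2 * s * c * N) / sqrt D"
    unfolding phi cos_diff ca sa cos_double sin_double s_def c_def
    by (simp add: add_divide_distrib)
  also have "(c\<^sup>2 - s\<^sup>2) * M + 2 * s * c * N = a * c\<^sup>2 - b * s\<^sup>2"
  proof -
    have "(c\<^sup>2 - s\<^sup>2) * M + 2 * s * c * N
        = (c\<^sup>2 - s\<^sup>2) * (a * c\<^sup>2 + b * s\<^sup>2) + 2 * (a - b) * (s\<^sup>2 * c\<^sup>2)"
      unfolding M_def N_def s_def c_def by (simp add: algebra_simps power2_eq_square)
    also have "\<dots> = a * c\<^sup>2 - b * s\<^sup>2"
      unfolding cs by (simp add: algebra_simps)
    finally show ?thesis .
  qed
  finally have cphi: "cos \<phi> = (a * c\<^sup>2 - b * s\<^sup>2) / sqrt D" .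
  have "sin \<phi> = (2 * s * c * M - (c\<^sup>2 - s\<^sup>2) * N) / sqrt D"
    unfolding phi sin_diff ca sa cos_double sin_double s_def c_def
    by (simp add: diff_divide_distrib)
  also have "2 * s * c * M - (c\<^sup>2 - s\<^sup>2) * N = (a + b) * (s * c)"
  proof -
    have "2 * s * c * M - (c\<^sup>2 - s\<^sup>2) * N
        = s * c * (2 * (a * c\<^sup>2 + b * s\<^sup>2) - (a - b) * (c\<^sup>2 - s\<^sup>2))"
      unfolding M_def N_def s_def c_def by (simp add: algebra_simps)
    also have "\<dots> = (a + b) * (s * c)"
      unfolding cs by (simp add: algebra_simps)
    finally show ?thesis .
  qed
  finally have sphi: "sin \<phi> = (a + b) * (s * c) / sqrt D" .
  have "((a + b) / 2)\<^sup>2 * (cos \<phi>)\<^sup>2 + (sqrt (a * b))\<^sup>2 * (sin \<phi>)\<^sup>2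
      = ((a + b) / 2)\<^sup>2 * ((a * c\<^sup>2 - b * s\<^sup>2)\<^sup>2 + 4 * (a * b) * (s * c)\<^sup>2) / D"
    unfolding cphi sphi using D assms(1,2)
    by (simp add: power_divide field_simps, algebra)
  also have "(a * c\<^sup>2 - b * s\<^sup>2)\<^sup>2 + 4 * (a * b) * (s * c)\<^sup>2 = M\<^sup>2"
    unfolding M_def s_def c_def by (simp add: algebra_simps power2_eq_square)
  finally show ?thesis
    by (simp only: power_mult_distrib)
qed

text \<open>Landen's substitution maps \<open>[0, \<pi>/2]\<close> to \<open>[0, \<pi>]\<close>, and its derivative \<open>1 + a b / D\<close> equals
  \<open>(a + b) M / D\<close>. The factor \<open>M\<close> cancels against the square root of the perfect square, which
  leaves twice the integrand for \<open>a\<close> and \<open>b\<close>; the two comes from the doubled range.\<close>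
theorem gauss_integral_agm_step:
  assumes ab: "0 < a" "0 < b"
  shows "gauss_integral ((a + b) / 2) (sqrt (a * b)) = gauss_integral a b"
proof -
  let ?\<alpha> = "\<lambda>t. arctan ((a - b) * (sin t * cos t) / (a * (cos t)\<^sup>2 + b * (sin t)\<^sup>2))"
  let ?M = "\<lambda>t. a * (cos t)\<^sup>2 + b * (sin t)\<^sup>2"
  let ?D = "\<lambda>t. a\<^sup>2 * (cos t)\<^sup>2 + b\<^sup>2 * (sin t)\<^sup>2"
  let ?\<phi> = "\<lambda>t. 2 * t - ?\<alpha> t"
  let ?f = "\<lambda>u. 1 / sqrt (((a + b) / 2)\<^sup>2 * (cos u)\<^sup>2 + (sqrt (a * b))\<^sup>2 * (sin u)\<^sup>2)"
  have ab1: "0 < (a + b) / 2" "0 < sqrt (a * b)"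
    using ab by auto
  have "((\<lambda>t. (1 + a * b / ?D t) *\<^sub>R ?f (?\<phi> t)) has_integral integral {?\<phi> 0..?\<phi> (pi/2)} ?f) {0..pi/2}"
  \<comment> \<open>The bounds \<open>-\<pi>\<close> and \<open>2 \<pi>\<close> contain the values of \<open>\<phi>\<close> because \<open>arctan\<close> has absolute value below \<open>\<pi> / 2\<close>.\<close>
  proof (rule has_integral_substitution[where c = "-pi" and d = "2 * pi"])
    show "?\<phi> ` {0..pi/2} \<subseteq> {-pi..2*pi}"
    proof clarify
      fix t :: real assume "t \<in> {0..pi/2}"
      then show "?\<phi> t \<in> {-pi..2*pi}"
        using arctan_bounded[of "(a - b) * (sin t * cos t) / ?M t"] by auto
    qed
    show "continuous_on {-pi..2*pi} ?f"
      by (rule continuous_on_gauss_integrand[OF ab1])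
    fix t :: real
    show "(?\<phi> has_real_derivative 1 + a * b / ?D t) (at t within {0..pi/2})"
      using DERIV_add[OF DERIV_ident DERIV_arctan_scaled_tan[OF ab]] by simp
  qed auto
  also have "integral {?\<phi> 0..?\<phi> (pi/2)} ?f = 2 * gauss_integral ((a + b) / 2) (sqrt (a * b))"
    using gauss_integral_half_period[OF ab1] by simp
  also have "(\<lambda>t. (1 + a * b / ?D t) *\<^sub>R ?f (?\<phi> t)) = (\<lambda>t. 2 * (1 / sqrt (?D t)))"
  proof
    fix t
    have M: "0 < ?M t" by (rule weighted_cos_sin_pos[OF ab])
    have D: "0 < ?D t" by (rule weighted_cos_sin_pos) (use ab in auto)
    have "?f (?\<phi> t) = sqrt (?D t) / ((a + b) / 2 * ?M t)"
      unfolding landen_substitution[OF ab] using M ab by (simp add: real_sqrt_divide)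
    moreover have "1 + a * b / ?D t = (a + b) * ?M t / ?D t"
    proof -
      have "?D t + a * b = (a + b) * ?M t"
        unfolding cos_squared_eq by (simp add: algebra_simps power2_eq_square)
      then show ?thesis
        using D by (simp add: field_simps)
    qed
    ultimately have "(1 + a * b / ?D t) *\<^sub>R ?f (?\<phi> t)
        = ((a + b) * ?M t / ?D t) * (sqrt (?D t) / ((a + b) / 2 * ?M t))"
      by simp
    also have "\<dots> = 2 * (sqrt (?D t) / ?D t)"
      using M ab by (simp add: divide_simps)
    also have "sqrt (?D t) / ?D t = 1 / sqrt (?D t)"
      using D by (simp add: real_div_sqrt field_simps)
    finally show "(1 + a * b / ?D t) *\<^sub>R ?f (?\<phi> t) = 2 * (1 / sqrt (?D t))" .
  qed
  finally have "((\<lambda>t. 2 * (1 / sqrt (?D t))) has_integral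
      2 * gauss_integral ((a + b) / 2) (sqrt (a * b))) {0..pi/2}" .
  from integral_unique[OF this] show ?thesis
    unfolding integral_mult_right by (simp add: gauss_integral_def)
qed

lemma gauss_integral_scale:
  assumes "0 < l"
  shows "gauss_integral (l * a) (l * b) = gauss_integral a b / l"
proof -
  have "sqrt ((l * a)\<^sup>2 * (cos t)\<^sup>2 + (l * b)\<^sup>2 * (sin t)\<^sup>2)
      = l * sqrt (a\<^sup>2 * (cos t)\<^sup>2 + b\<^sup>2 * (sin t)\<^sup>2)" for t
  proof -
    have "(l * a)\<^sup>2 * (cos t)\<^sup>2 + (l * b)\<^sup>2 * (sin t)\<^sup>2
        = l\<^sup>2 * (a\<^sup>2 * (cos t)\<^sup>2 + b\<^sup>2 * (sin t)\<^sup>2)"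
      by (simp add: algebra_simps)
    then show ?thesis
      using assms by (simp add: real_sqrt_mult)
  qed
  then have "gauss_integral (l * a) (l * b)
      = integral {0..pi/2} (\<lambda>t. 1 / l * (1 / sqrt (a\<^sup>2 * (cos t)\<^sup>2 + b\<^sup>2 * (sin t)\<^sup>2)))"
    by (simp add: gauss_integral_def)
  also have "\<dots> = gauss_integral a b / l"
    unfolding gauss_integral_def integral_mult_right by simp
  finally show ?thesis .
qed

lemma ellipticK_eq_gauss_integral:
  assumes "0 \<le> 1 - r\<^sup>2"
  shows "ellipticK r = gauss_integral 1 (sqrt (1 - r\<^sup>2))"
  using assms by (simp add: ellipticK_def gauss_integral_def cos_squared_eq algebra_simps)

text \<open>The number \<open>k = 3 - 2 \<surd>2 = (\<surd>2 - 1)\<^sup>2\<close> is the solution of \<open>1 - k = 2 \<surd>k\<close>. One mean step gives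
  \<open>\<^bold>K(k)\<close> from the pair \<open>(1 + k, 1 - k)\<close>, which is now twice the pair of means of \<open>(1, k)\<close>, and
  the pair \<open>(1, k)\<close> belongs to the complementary modulus. Hence \<open>\<^bold>K(\<surd>(1 - k\<^sup>2)) = 2 \<^bold>K(k)\<close>.\<close>
lemma groetzsch_mu_at_pi: "groetzsch_mu (3 - 2 * sqrt 2) = pi"
proof -
  define k :: real where "k = 3 - 2 * sqrt 2"
  have s2: "1 < sqrt 2" "sqrt 2 < (3/2::real)"
    using real_less_lsqrt[of "3/2" 2] by (simp_all add: power2_eq_square)
  have k: "0 < k" "k < 1" using s2 by (auto simp: k_def)
  have k2: "k\<^sup>2 < 1" using k by (simp add: abs_square_less_1)
  have "k = (sqrt 2 - 1)\<^sup>2" by (simp add: k_def power2_eq_square algebra_simps)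
  then have sk: "sqrt k = sqrt 2 - 1" using s2 by simp
  have "ellipticK k = gauss_integral 1 (sqrt (1 - k\<^sup>2))"
    using k2 by (simp add: ellipticK_eq_gauss_integral)
  also have "\<dots> = gauss_integral (1 + k) (1 - k)"
    using gauss_integral_agm_step[of "1 + k" "1 - k"] k
    by (simp add: algebra_simps power2_eq_square)
  also have "\<dots> = gauss_integral (2 * ((1 + k) / 2)) (2 * sqrt (1 * k))"
    by (rule arg_cong2[where f = gauss_integral]) (simp, simp add: sk, simp add: k_def)
  also have "\<dots> = gauss_integral 1 k / 2"
    unfolding gauss_integral_scale[OF zero_less_numeral]
    using gauss_integral_agm_step[of 1 k] k by simp
  also have "gauss_integral 1 k = ellipticK (sqrt (1 - k\<^sup>2))"
    using k k2 by (simp add: ellipticK_eq_gauss_integral)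
  finally have "ellipticK (sqrt (1 - k\<^sup>2)) = 2 * ellipticK k" by simp
  moreover have "ellipticK k \<noteq> 0"
    using ellipticK_pos[of k] k by simp
  ultimately show ?thesis
    by (simp add: groetzsch_mu_def k_def)
qed

section \<open>Elementary bounds and the starting point\<close>

text \<open>With \<open>k = \<surd>(1 - r\<^sup>2)\<close>, the Cauchy-Schwarz inequality for the weights \<open>cos\<^sup>2 t\<close> and \<open>sin\<^sup>2 t\<close> gives
  \<open>cos\<^sup>2 t + k sin\<^sup>2 t \<le> \<surd>(cos\<^sup>2 t + k\<^sup>2 sin\<^sup>2 t)\<close>, and the reciprocal of the left side has the
  elementary antiderivative \<open>arctan (\<surd>k tan t) / \<surd>k\<close>. In terms of means, the
  arithmetic-geometric mean of \<open>1\<close> and \<open>k\<close> is at least their geometric mean.\<close>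
lemma ellipticK_upper_bound:
  assumes "0 \<le> r" "r < 1"
  shows "ellipticK r \<le> pi / (2 * sqrt (sqrt (1 - r\<^sup>2)))"
proof -
  define k where "k = sqrt (1 - r\<^sup>2)"
  define q where "q = sqrt k"
  have r2: "r\<^sup>2 < 1" using assms by (simp add: abs_square_less_1)
  then have k: "0 < k" by (simp add: k_def)
  then have q: "0 < q" "q\<^sup>2 = k" by (auto simp: q_def)
  let ?\<psi> = "\<lambda>t. t - arctan ((1 - q) * (sin t * cos t) / (1 * (cos t)\<^sup>2 + q * (sin t)\<^sup>2))"
  have "((\<lambda>t. 1 * q / (1\<^sup>2 * (cos t)\<^sup>2 + q\<^sup>2 * (sin t)\<^sup>2)) has_integral ?\<psi> (pi/2) - ?\<psi> 0) {0..pi/2}"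
    by (intro fundamental_theorem_of_calculus DERIV_arctan_scaled_tan q(1) zero_less_one
        has_real_derivative_iff_has_vector_derivative[THEN iffD1]) simp
  from has_integral_mult_right[OF this, of "1 / q"]
  have "((\<lambda>t. 1 / ((cos t)\<^sup>2 + k * (sin t)\<^sup>2)) has_integral pi / (2 * q)) {0..pi/2}"
    using q by (simp add: mult.commute)
  moreover have "((\<lambda>t. 1 / sqrt (1\<^sup>2 * (cos t)\<^sup>2 + k\<^sup>2 * (sin t)\<^sup>2)) has_integral ellipticK r) {0..pi/2}"
    unfolding ellipticK_eq_gauss_integral[OF less_imp_le[OF diff_gt_0_iff_gt[THEN iffD2, OF r2]], folded k_def] gauss_integral_def
    by (intro integrable_integral integrable_continuous_real continuous_on_gauss_integrand)
      (use k in auto)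
  moreover have "1 / sqrt (1\<^sup>2 * (cos t)\<^sup>2 + k\<^sup>2 * (sin t)\<^sup>2) \<le> 1 / ((cos t)\<^sup>2 + k * (sin t)\<^sup>2)" for t
  proof -
    have p: "0 < (cos t)\<^sup>2 + k * (sin t)\<^sup>2"
      using weighted_cos_sin_pos[of 1 k t] k by simp
    have "(1 * (cos t)\<^sup>2 + k * (sin t)\<^sup>2)\<^sup>2 \<le> 1\<^sup>2 * (cos t)\<^sup>2 + k\<^sup>2 * (sin t)\<^sup>2"
      unfolding weighted_cos_sin_square[symmetric] by simp
    then have "(cos t)\<^sup>2 + k * (sin t)\<^sup>2 \<le> sqrt (1\<^sup>2 * (cos t)\<^sup>2 + k\<^sup>2 * (sin t)\<^sup>2)"
      by (intro real_le_rsqrt) simp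
    then show ?thesis
      using p by (simp add: frac_le)
  qed
  ultimately show ?thesis
    unfolding k_def[symmetric] q_def[symmetric] by (blast intro: has_integral_le)
qed

text \<open>Here \<open>artanh s / \<surd>s\<close> is the integral of \<open>\<surd>s cos t / (1 - s\<^sup>2 sin\<^sup>2 t)\<close>, and this integrand is
  smaller than that of \<open>\<^bold>K(s)\<close> because \<open>s cos\<^sup>2 t < 1 - s\<^sup>2 sin\<^sup>2 t\<close>. The power \<open>\<surd>s\<close> is the one that
  cancels against the upper bound of \<open>\<^bold>K\<close> at the complementary modulus.\<close>
lemma ellipticK_lower_bound:
  assumes "0 < s" "s < 1"
  shows "artanh s / sqrt s < ellipticK s"
proof -
  have bd: "\<bar>s * sin t\<bar> < 1" for t
  proof -
    have "\<bar>s\<bar> * \<bar>sin t\<bar> \<le> \<bar>s\<bar> * 1" by (intro mult_left_mono) auto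
    also have "\<dots> < 1" using assms by simp
    finally show ?thesis by (simp only: abs_mult)
  qed
  have p: "0 < 1 - s\<^sup>2 * (sin t)\<^sup>2" for t
    using bd[of t] by (simp add: abs_square_less_1 flip: power_mult_distrib)
  have "((\<lambda>t. sqrt s * cos t / (1 - s\<^sup>2 * (sin t)\<^sup>2)) has_integral
          artanh (s * sin (pi/2)) / sqrt s - artanh (s * sin 0) / sqrt s) {0..pi/2}"
  proof (rule fundamental_theorem_of_calculus)
    fix t :: real
    have "((\<lambda>t. s * sin t) has_real_derivative s * cos t) (at t within {0..pi/2})"
      by (auto intro!: derivative_eq_intros)
    from DERIV_cdivide[OF DERIV_chain2[OF artanh_real_has_field_derivative[OF bd] this], of "sqrt s"]
    have "((\<lambda>t. artanh (s * sin t) / sqrt s) has_real_derivative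
        (s / sqrt s) * cos t / (1 - s\<^sup>2 * (sin t)\<^sup>2)) (at t within {0..pi/2})"
      by (simp add: power_mult_distrib mult_ac)
    then show "((\<lambda>t. artanh (s * sin t) / sqrt s) has_vector_derivative
        sqrt s * cos t / (1 - s\<^sup>2 * (sin t)\<^sup>2)) (at t within {0..pi/2})"
      using assms by (simp add: real_div_sqrt flip: has_real_derivative_iff_has_vector_derivative)
  qed simp
  then have "artanh s / sqrt s = integral {0..pi/2} (\<lambda>t. sqrt s * cos t / (1 - s\<^sup>2 * (sin t)\<^sup>2))"
    by (simp add: integral_unique)
  also have "\<dots> < integral {0..pi/2} (\<lambda>t. 1 / sqrt (1 - s\<^sup>2 * (sin t)\<^sup>2))"
  proof (rule integral_less_real)
    show "continuous_on {0..pi/2} (\<lambda>t. sqrt s * cos t / (1 - s\<^sup>2 * (sin t)\<^sup>2))"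
      and "continuous_on {0..pi/2} (\<lambda>t. 1 / sqrt (1 - s\<^sup>2 * (sin t)\<^sup>2))"
      using p by (auto intro!: continuous_intros simp: less_imp_neq[symmetric])
    show "{0<..<pi/2} \<noteq> {}" by (simp add: not_le)
    fix t assume "t \<in> {0<..<pi/2}"
    let ?D = "1 - s\<^sup>2 * (sin t)\<^sup>2"
    have "?D - s * (cos t)\<^sup>2 = (1 - s) * (1 + s * (sin t)\<^sup>2)"
      unfolding cos_squared_eq by (simp add: algebra_simps power2_eq_square)
    also have "\<dots> > 0"
      using assms by (intro mult_pos_pos add_pos_nonneg) auto
    finally have "sqrt (s * (cos t)\<^sup>2) < sqrt ?D" by simp
    then have "sqrt s * cos t < sqrt ?D"
      using \<open>t \<in> {0<..<pi/2}\<close> cos_ge_zero[of t] by (simp add: real_sqrt_mult)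
    then have "sqrt s * cos t / ?D < sqrt ?D / ?D"
      using p by (intro divide_strict_right_mono)
    also have "sqrt ?D / ?D = 1 / sqrt ?D"
      using p[of t] by (simp add: field_simps)
    finally show "sqrt s * cos t / ?D < 1 / sqrt ?D" .
  qed
  finally show ?thesis by (simp add: ellipticK_def)
qed

lemma groetzsch_mu_sech_gt:
  assumes "0 < y"
  shows "y < groetzsch_mu (1 / cosh y)"
proof -
  define r where "r = 1 / cosh y"
  define s where "s = tanh y"
  have s: "0 < s" "s < 1"
    using assms by (simp_all add: s_def tanh_real_lt_1)
  have c: "1 < cosh y"
    using cosh_real_nonneg_less_iff[of 0 y] assms by simp
  then have r: "0 < r" "r < 1"
    by (simp_all add: r_def)
  have "1 - r\<^sup>2 = s\<^sup>2"
    using c sinh_square_eq[of y]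
    by (simp add: r_def s_def tanh_def power_divide diff_divide_distrib)
  then have rs: "sqrt (1 - r\<^sup>2) = s"
    using s by simp
  have "y / sqrt s < ellipticK s"
    using ellipticK_lower_bound[OF s] by (simp add: s_def artanh_tanh_real)
  moreover have "0 < ellipticK r" "ellipticK r \<le> pi / (2 * sqrt s)"
    using ellipticK_pos[of r] ellipticK_upper_bound[of r] r rs by simp_all
  ultimately have "y / sqrt s / (pi / (2 * sqrt s)) < ellipticK s / ellipticK r"
    using assms s by (intro frac_less) auto
  then have "pi / 2 * (y / sqrt s / (pi / (2 * sqrt s))) < pi / 2 * (ellipticK s / ellipticK r)"
    by (intro mult_strict_left_mono) auto
  moreover have "pi / 2 * (y / sqrt s / (pi / (2 * sqrt s))) = y"
    using s by simp
  ultimately show ?thesis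
    using rs by (simp add: groetzsch_mu_def r_def)
qed

section \<open>Newton's iteration\<close>

lemma groetzsch_mu_inv_eq:
  assumes "0 < p" "p < 1" "groetzsch_mu p = y"
  shows "groetzsch_mu_inv y = p"
  unfolding groetzsch_mu_inv_def
proof (rule the_inv_into_f_eq)
  show "inj_on groetzsch_mu {0<..<1}"
  proof (rule linorder_inj_onI)
    fix r s :: real assume "r < s" "r \<in> {0<..<1}" "s \<in> {0<..<1}"
    then show "groetzsch_mu r \<noteq> groetzsch_mu s"
      using groetzsch_mu_strict_antimono[of r s] by simp
  qed auto
qed (use assms in auto)

lemma groetzsch_mu_inv_bounds:
  assumes "pi < y"
  shows "groetzsch_mu (groetzsch_mu_inv y) = y"
    and "1 / cosh y < groetzsch_mu_inv y"
    and "groetzsch_mu_inv y < 3 - 2 * sqrt 2"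
proof -
  define k :: real where "k = 3 - 2 * sqrt 2"
  have "1 < sqrt (2::real)" "sqrt 2 < (3/2::real)"
    using real_less_lsqrt[of "3/2" 2] by (simp_all add: power2_eq_square)
  then have k: "0 < k" "k < 1" by (auto simp: k_def)
  have mk: "groetzsch_mu k < y"
    using groetzsch_mu_at_pi assms by (simp add: k_def)
  have y: "0 < y" using assms pi_gt_zero by linarith
  then have mr: "y < groetzsch_mu (1 / cosh y)"
    by (rule groetzsch_mu_sech_gt)
  have r: "0 < 1 / cosh y" "1 / cosh y < 1"
    using cosh_real_nonneg_less_iff[of 0 y] y by simp_all
  have rk: "1 / cosh y < k"
    using groetzsch_mu_strict_antimono[of k "1 / cosh y"] k r mk mr
    by (cases "1 / cosh y" k rule: linorder_cases) auto
  have "\<exists>p. 1 / cosh y \<le> p \<and> p \<le> k \<and> groetzsch_mu p = y"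
  proof (rule IVT2)
    show "\<forall>x. 1 / cosh y \<le> x \<and> x \<le> k \<longrightarrow> isCont groetzsch_mu x"
    proof (intro allI impI)
      fix x assume "1 / cosh y \<le> x \<and> x \<le> k"
      then have "0 < x" "x < 1" using r(1) k(2) by linarith+
      then have "x \<in> {0<..<1}" by simp
      then show "isCont groetzsch_mu x"
        by (intro field_differentiable_imp_continuous_at deriv_groetzsch_mu)
    qed
  qed (use mk mr rk in auto)
  then obtain p where p: "1 / cosh y \<le> p" "p \<le> k" "groetzsch_mu p = y"
    by blast
  have pr: "0 < p" "p < 1" using p(1,2) r(1) k(2) by linarith+
  have inv: "groetzsch_mu_inv y = p"
    using pr p(3) by (rule groetzsch_mu_inv_eq)
  have "p \<noteq> 1 / cosh y" "p \<noteq> k" using p(3) mk mr by auto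
  with p inv show "groetzsch_mu (groetzsch_mu_inv y) = y"
    "1 / cosh y < groetzsch_mu_inv y" "groetzsch_mu_inv y < 3 - 2 * sqrt 2"
    by (auto simp: k_def)
qed

text \<open>By the mean value theorem the secant slope from \<open>x\<close> to the root \<open>p\<close> is a derivative at an
  intermediate point, hence larger than the slope at \<open>x\<close>. The tangent at \<open>x\<close> is thus steeper and
  reaches the level \<open>f p\<close> before \<open>p\<close>.\<close>
lemma newton_step_below_root:
  fixes f :: "real \<Rightarrow> real"
  assumes "x < p" and "f p < f x" and "deriv f x < 0"
    and diff: "\<And>z. x \<le> z \<Longrightarrow> z \<le> p \<Longrightarrow> f field_differentiable at z"
    and conv: "\<And>z. x < z \<Longrightarrow> z < p \<Longrightarrow> deriv f x < deriv f z"
  shows "x < x - (f x - f p) / deriv f x" and "x - (f x - f p) / deriv f x < p"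
proof -
  have "(f x - f p) / deriv f x < 0"
    using assms by (simp add: divide_pos_neg)
  then show "x < x - (f x - f p) / deriv f x" by simp
  obtain z where z: "x < z" "z < p" "f p - f x = (p - x) * deriv f z"
    using MVT2[OF \<open>x < p\<close>, of f "deriv f"] diff
    by (auto simp: DERIV_deriv_iff_field_differentiable)
  have "(p - x) * deriv f x < (p - x) * deriv f z"
    using conv[OF z(1,2)] \<open>x < p\<close> by simp
  then have "(p - x) * deriv f x < f p - f x"
    using z(3) by simp
  then have "(f p - f x) / deriv f x < p - x"
    using \<open>deriv f x < 0\<close> by (simp add: neg_divide_less_eq)
  moreover have "(f p - f x) / deriv f x = - ((f x - f p) / deriv f x)"
    by (simp add: diff_divide_distrib)
  ultimately show "x - (f x - f p) / deriv f x < p" by simp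
qed

theorem corollary4p2:
  fixes y :: real and x :: "nat \<Rightarrow> real"
  assumes "y > pi"
    and "x 0 = 1 / cosh y"
    and "\<And>n. x (Suc n) = x n - (groetzsch_mu (x n) - y) / deriv groetzsch_mu (x n)"
  shows "\<forall>n. 0 < x n \<and> x n < x (Suc n) \<and> x (Suc n) < groetzsch_mu_inv y
    \<and> groetzsch_mu_inv y < 3 - 2 * sqrt 2 \<and> 3 - 2 * sqrt 2 < (1::real)"
proof -
  define p where "p = groetzsch_mu_inv y"
  have p: "groetzsch_mu p = y" "x 0 < p" "p < 3 - 2 * sqrt 2"
    using groetzsch_mu_inv_bounds[OF assms(1)] assms(2) by (simp_all add: p_def)
  have s2: "sqrt 2 > (5/4::real)"
    by (rule real_less_rsqrt) (simp add: power2_eq_square)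
  then have k1: "3 - 2 * sqrt 2 < (1::real)" by simp
  \<comment> \<open>The number \<open>1/2\<close> separates \<open>3 - 2 \<surd>2\<close> from \<open>1 / \<surd>3\<close>, up to which \<open>\<mu>\<close> is known to be convex.\<close>
  have p1: "p < 1/2" using p(3) s2 by simp
  have step: "x n < x (Suc n) \<and> x (Suc n) < p" if "0 < x n" "x n < p" for n
  proof -
    have le: "3 * z\<^sup>2 \<le> 1" if "0 < z" "z < p" for z
      using mult_mono[of z "1/2" z "1/2"] that p1 by (simp add: power2_eq_square)
    have mem: "z \<in> {0<..<1}" if "x n \<le> z" "z \<le> p" for z
      using that \<open>0 < x n\<close> p1 by auto
    have "groetzsch_mu p < groetzsch_mu (x n)"
      using groetzsch_mu_strict_antimono[of "x n" p] that p1 by simp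
    moreover have "deriv groetzsch_mu (x n) < 0"
      using mem that by (intro deriv_groetzsch_mu) auto
    moreover have "groetzsch_mu field_differentiable at z" if "x n \<le> z" "z \<le> p" for z
      using mem that by (intro deriv_groetzsch_mu) auto
    moreover have "deriv groetzsch_mu (x n) < deriv groetzsch_mu z" if "x n < z" "z < p" for z
      using that \<open>0 < x n\<close> le by (intro deriv_groetzsch_mu) auto
    ultimately show ?thesis
      using newton_step_below_root[of "x n" p groetzsch_mu] \<open>x n < p\<close>
      unfolding assms(3) p(1) by blast
  qed
  have "0 < x n \<and> x n < p" for n
  proof (induction n)
    case 0
    then show ?case using p(2) assms(2) by simp
  next
    case (Suc n)
    then show ?case using step[of n] by auto
  qed
  with step p(3) k1 show ?thesis
    unfolding p_def by blast
qed

end
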